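(* Let $\mathcal A$ be an associative unital $\mathbb C$-algebra, $A,B\in\mathcal A$, and $h,s\in\mathbb C$. Then the following are equivalent: (i) $[B,A]=hA^{s+1}$; (ii) for all $n\in\mathbb N$, \[ (A+B)^n=\sum_{k=0}^n\binom{n}{k}\Big(\sum_{j=0}^k\mathfrak S_s(k,j)h^{k-j}A^{s(k-j)+j}\Big)B^{n-k}=\sum_{k=0}^nh^{n-k}\sum_{j=0}^k\binom{n}{j}\mathfrak S_s(n-j,k-j)A^{s(n-k)+k-j}B^j; \] (iii) for all $t$, $e^{(A+B)t}=\exp\!\left(\frac{\mathfrak F_s(hA^st)}{hA^{s-1}}\right)e^{Bt}$.
   Context: $[X,Y]=XY-YX$; $e^X=\sum_{n\ge0}X^n/n!$. Powers $A^x$ for complex $x$ are assumed given and to satisfy $A^xA^y=A^{x+y}$, $A^0=1$, $A^1=A$, and to commute with each other. The generalized Stirling numbers are $\mathfrak S_s(n,k):=\sum_{j=k}^n{n\brack j}{j\brace k}s^{n-j}(1-s)^{j-k}$ (with $0^0=1$), where ${n\brack j}$ are the unsigned Stirling numbers of the first kind ($x(x-1)\cdots(x-n+1)=\sum_j{n\brack j}(-1)^{n-j}x^j$) and ${j\brace k}$ those of the second kind ($x^j=\sum_k{j\brace k}x(x-1)\cdots(x-k+1)$). $\mathfrak F_s(t)$ is $e^t-1$ if $s=0$, $-\log(1-t)$ if $s=1$, and $\frac{1-(1-st)^{1-1/s}}{s-1}$ otherwise; it satisfies $\sum_{n\ge k}\mathfrak S_s(n,k)t^n/n!=\mathfrak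 F_s(t)^k/k!$. The expression $\frac{\mathfrak F_s(hA^st)}{hA^{s-1}}$ denotes the formal series $\sum_{n\ge1}\mathfrak S_s(n,1)h^{n-1}A^{s(n-1)+1}t^n/n!$. Series are treated formally; identities in $t$ are equalities of formal power series in $t$ with coefficients in $\mathcal A$.
   Formalization: For s not an integer, the given powers are also assumed to satisfy: if [[B,A],A]=0 then [B,A^s]=sA^{s-1}[B,A]; without this rule (i) does not imply (ii), as the listed power laws alone do not determine how B commutes with A^s. *)

theory Defs
  imports
    "HOL-Computational_Algebra.Formal_Power_Series"
    "HOL-Combinatorics.Stirling"
begin

text \<open>
  The sort \<open>{ring, monoid_mult}\<close> is used instead of \<open>ring_1\<close>, because the latter requires
  \<open>0 \<noteq> 1\<close> and so excludes the zero algebra.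
\<close>

locale complex_algebra = vector_space scale
  for scale :: "complex \<Rightarrow> 'a \<Rightarrow> 'a::{ring, monoid_mult}" +
  assumes scale_mult_left: "scale c x * y = scale c (x * y)"
    and scale_mult_right: "x * scale c y = scale c (x * y)"

definition commutator :: "'a::ring \<Rightarrow> 'a \<Rightarrow> 'a" where
  "commutator x y = x * y - y * x"

text \<open>
  \<open>P x\<close> plays the role of \<open>A\<^sup>x\<close>. These laws determine \<open>P\<close> on the integers only. In particular
  \<open>[B, A] = h A\<^sup>s\<^sup>+\<^sup>1\<close> does not imply the usual rule \<open>[B, A\<^sup>s] = s A\<^sup>s\<^sup>-\<^sup>1 [B, A]\<close> when \<open>s\<close> is not an
  integer, and the noncommutative binomial formula for \<open>A + B\<close> fails without it. Example with
  \<open>s = 1/2\<close>: among the \<open>2 \<times> 2\<close> matrices over the operators on smooth functions of \<open>x > 0\<close>, let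
  \<open>P z = diag (x\<^sup>-\<^sup>2\<^sup>z, e\<^sup>2\<^sup>\<pi>\<^sup>i\<^sup>z x\<^sup>-\<^sup>2\<^sup>z)\<close> and \<open>B = diag (D, -D) + E\<close>, where \<open>D = -(h/2) d/dx\<close> and \<open>E\<close>
  swaps the two coordinates.
\<close>

definition complex_powers :: "(complex \<Rightarrow> 'a::{ring, monoid_mult}) \<Rightarrow> 'a \<Rightarrow> bool" where
  "complex_powers P A \<longleftrightarrow>
     P 0 = 1 \<and> P 1 = A \<and> (\<forall>x y. P x * P y = P (x + y)) \<and> (\<forall>x y. P x * P y = P y * P x)"

definition gen_stirling :: "complex \<Rightarrow> nat \<Rightarrow> nat \<Rightarrow> complex" where
  "gen_stirling s n k =
     (\<Sum>j=k..n. of_nat (stirling n j) * of_nat (Stirling j k) * s ^ (n - j) * (1 - s) ^ (j - k))"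

instance fps :: ("{semiring_0, monoid_mult}") monoid_mult
proof
  fix a b c :: "'a fps"
  show "1 * a = a" "a * 1 = a"
    by (simp_all add: fps_eq_iff fps_mult_nth mult_delta_left mult_delta_right)
qed

definition fps_scale :: "(complex \<Rightarrow> 'a \<Rightarrow> 'a) \<Rightarrow> complex \<Rightarrow> 'a fps \<Rightarrow> 'a fps" where
  "fps_scale scale c F = Abs_fps (\<lambda>n. scale c (fps_nth F n))"

text \<open>
  The infinite sum is taken in the \<open>t\<close>-adic topology of formal power series; it converges
  when \<open>F\<close> has zero constant term.
\<close>

definition formal_exp ::
  "(complex \<Rightarrow> 'a \<Rightarrow> 'a) \<Rightarrow> 'a::{ring, monoid_mult} fps \<Rightarrow> 'a fps" where
  "formal_exp scale F = (\<Sum>n. fps_scale scale (1 / fact n) (F ^ n))"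

text \<open>
  The series written \<open>F\<^sub>s(h A\<^sup>s t) / (h A\<^sup>s\<^sup>-\<^sup>1)\<close>, where \<open>F\<^sub>s\<close> is the exponential generating
  function of \<open>gen_stirling s n 1\<close>. The division is only notation, so \<open>h = 0\<close> is allowed.
\<close>

definition exponent_series ::
  "(complex \<Rightarrow> 'a \<Rightarrow> 'a) \<Rightarrow> (complex \<Rightarrow> 'a::{ring, monoid_mult}) \<Rightarrow> complex \<Rightarrow> complex \<Rightarrow> 'a fps" where
  "exponent_series scale P h s =
     Abs_fps (\<lambda>n. if n = 0 then 0
        else scale (gen_stirling s n 1 * h ^ (n - 1) / fact n) (P (s * of_nat (n - 1) + 1)))"

lemma fps_power_nth_eq_0:
  fixes F :: "'a::{ring, monoid_mult} fps"
  assumes "fps_nth F 0 = 0" "n < k"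
  shows "fps_nth (F ^ k) n = 0"
  using assms(2)
proof (induction k arbitrary: n)
  case 0
  then show ?case by simp
next
  case (Suc k)
  have "fps_nth F i * fps_nth (F ^ k) (n - i) = 0" if "i \<le> n" for i
  proof (cases "i = 0")
    case True
    then show ?thesis using assms(1) by simp
  next
    case False
    then have "n - i < k" using Suc.prems that by simp
    then show ?thesis using Suc.IH by simp
  qed
  then show ?case by (simp add: fps_mult_nth)
qed

lemma (in complex_algebra) formal_exp_nth:
  assumes "fps_nth F 0 = 0"
  shows "fps_nth (formal_exp scale F) n = (\<Sum>k\<le>n. scale (1 / fact k) (fps_nth (F ^ k) n))"
proof -
  let ?f = "\<lambda>k. fps_scale scale (1 / fact k) (F ^ k)"
  let ?G = "Abs_fps (\<lambda>n. \<Sum>k\<le>n. scale (1 / fact k) (fps_nth (F ^ k) n))"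
  have nth: "fps_nth (\<Sum>k<m. ?f k) i = fps_nth ?G i" if "i < m" for i m
  proof -
    have "fps_nth (\<Sum>k<m. ?f k) i = (\<Sum>k<m. scale (1 / fact k) (fps_nth (F ^ k) i))"
      by (simp add: fps_sum_nth fps_scale_def)
    also have "\<dots> = (\<Sum>k\<le>i. scale (1 / fact k) (fps_nth (F ^ k) i))"
      using that by (intro sum.mono_neutral_right) (auto simp: fps_power_nth_eq_0[OF assms])
    finally show ?thesis by simp
  qed
  have "?f sums ?G"
    unfolding sums_def
  proof (rule tendsto_fpsI)
    fix i
    show "eventually (\<lambda>m. fps_nth (\<Sum>k<m. ?f k) i = fps_nth ?G i) sequentially"
      using eventually_gt_at_top[of i] by eventually_elim (rule nth)
  qed
  then have "formal_exp scale F = ?G"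
    unfolding formal_exp_def by (simp add: sums_iff)
  then show ?thesis by simp
qed

end

theory Submission
  imports Defs
begin

text \<open>
  If \<open>[B, A] = h A\<^sup>s\<^sup>+\<^sup>1\<close>, then \<open>[B, A\<^sup>x] = h x A\<^sup>x\<^sup>+\<^sup>s\<close> holds on a set of exponents \<open>x\<close> that is an
  additive group containing \<open>1\<close> and \<open>s\<close>. With \<open>R\<^sub>k = \<Sum>\<^sub>j S\<^sub>s(k,j) h\<^sup>k\<^sup>-\<^sup>j A\<^sup>s\<^sup>(\<^sup>k\<^sup>-\<^sup>j\<^sup>)\<^sup>+\<^sup>j\<close>, the recurrence
  \<open>S\<^sub>s(k+1,j) = S\<^sub>s(k,j-1) + (s (k-j) + j) S\<^sub>s(k,j)\<close> then says \<open>R\<^sub>k\<^sub>+\<^sub>1 = A R\<^sub>k + [B, R\<^sub>k]\<close>, which gives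
  the first expansion in (ii) by induction; the second one is a reindexing of the first. Conversely, the case
  \<open>n = 2\<close> of (ii) is (i). The same recurrence is satisfied by the coefficients of \<open>f\<^sup>k / k!\<close>, where
  \<open>f = \<Sum>\<^sub>n S\<^sub>s(n,1) t\<^sup>n / n!\<close>; hence the exponential of the exponent series is \<open>\<Sum>\<^sub>k R\<^sub>k t\<^sup>k / k!\<close>, and
  (iii) is (ii) read off coefficient by coefficient, whether or not (i) holds.
\<close>

section \<open>Recurrence of the generalized Stirling numbers\<close>

lemma gen_stirling_eq_sum_atMost:
  "gen_stirling s n k =
     (\<Sum>j\<le>n. of_nat (stirling n j) * of_nat (Stirling j k) * s ^ (n - j) * (1 - s) ^ (j - k))"
  unfolding gen_stirling_def
  by (intro sum.mono_neutral_left) (auto simp: not_le)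

lemma gen_stirling_0_left: "gen_stirling s 0 k = (if k = 0 then 1 else 0)"
  by (cases k) (simp_all add: gen_stirling_eq_sum_atMost)

lemma gen_stirling_Suc_0: "gen_stirling s (Suc n) 0 = 0"
proof -
  have "of_nat (stirling (Suc n) j) * of_nat (Stirling j 0) = (0 :: complex)" for j
    by (cases j) simp_all
  then show ?thesis
    unfolding gen_stirling_eq_sum_atMost by (simp only: mult_zero_left sum.neutral_const)
qed

text \<open>After the shift \<open>j\<close> to \<open>Suc j\<close>, the recurrence of the first
  kind splits the sum in two. The part with factor \<open>n\<close> gives the summand
  \<open>s * n\<close>; in the other part the recurrence of the second kind gives
  \<open>(1 - s) * Suc k\<close>.\<close>

lemma gen_stirling_Suc_Suc:
  "gen_stirling s (Suc n) (Suc k) =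
     gen_stirling s n k + (s * of_nat n + (1 - s) * of_nat (Suc k)) * gen_stirling s n (Suc k)"
proof -
  let ?g = "\<lambda>k j. of_nat (stirling n j) * of_nat (Stirling j k) * s ^ (n - j) * (1 - s) ^ (j - k)"
  let ?h = "\<lambda>j. of_nat (stirling n j) * of_nat (Stirling (Suc j) (Suc k)) * s ^ (n - j) * (1 - s) ^ (j - k)"
  \<comment> \<open>The factor \<open>1 - s\<close> lowers the exponent \<open>j - k\<close> to
    \<open>j - Suc k\<close>. Truncation interferes only for \<open>j \<le> k\<close>, where
    \<open>Stirling j (Suc k) = 0\<close>.\<close>
  have shift: "?h j = ?g k j + (1 - s) * of_nat (Suc k) * ?g (Suc k) j" for j
  proof (cases "j \<ge> Suc k")
    case True
    then have eq: "(1 - s) ^ (j - k) = (1 - s) * (1 - s) ^ (j - Suc k)"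
      by (metis Suc_diff_le diff_Suc_Suc power_Suc)
    show ?thesis unfolding eq by (simp add: algebra_simps)
  qed simp
  have "gen_stirling s (Suc n) (Suc k) =
    (\<Sum>j\<le>n. of_nat (stirling (Suc n) (Suc j)) * of_nat (Stirling (Suc j) (Suc k))
       * s ^ (n - j) * (1 - s) ^ (j - k))"
    unfolding gen_stirling_eq_sum_atMost by (subst sum.atMost_Suc_shift) simp
  also have "\<dots> = (\<Sum>j\<le>n. ?h j)
      + (\<Sum>j\<le>n. of_nat n * of_nat (stirling n (Suc j)) * of_nat (Stirling (Suc j) (Suc k))
           * s ^ (n - j) * (1 - s) ^ (j - k))"
    unfolding sum.distrib[symmetric]
    by (intro sum.cong) (simp_all only: stirling.simps of_nat_add of_nat_mult, simp add: algebra_simps)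
  also have "(\<Sum>j\<le>n. of_nat n * of_nat (stirling n (Suc j)) * of_nat (Stirling (Suc j) (Suc k))
           * s ^ (n - j) * (1 - s) ^ (j - k)) = s * of_nat n * gen_stirling s n (Suc k)"
  proof -
    have "s * of_nat n * gen_stirling s n (Suc k) = (\<Sum>j\<le>Suc n. s * of_nat n * ?g (Suc k) j)"
      unfolding gen_stirling_eq_sum_atMost sum_distrib_left by simp
    also have "\<dots> = (\<Sum>j\<le>n. s * of_nat n * ?g (Suc k) (Suc j))"
      by (subst sum.atMost_Suc_shift) simp
    also have "\<dots> = (\<Sum>j\<le>n. of_nat n * of_nat (stirling n (Suc j)) * of_nat (Stirling (Suc j) (Suc k))
           * s ^ (n - j) * (1 - s) ^ (j - k))"
    proof (intro sum.cong refl)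
      fix j assume "j \<in> {..n}"
      \<comment> \<open>At \<open>j = n\<close> the exponents do not match, but there
        \<open>stirling n (Suc n) = 0\<close>.\<close>
      have "s ^ (n - j) = s * s ^ (n - Suc j)" if "j < n"
        using that by (metis Suc_diff_Suc power_Suc)
      moreover have "stirling n (Suc j) = 0" if "\<not> j < n"
        using that by simp
      ultimately show "s * of_nat n * ?g (Suc k) (Suc j) =
          of_nat n * of_nat (stirling n (Suc j)) * of_nat (Stirling (Suc j) (Suc k))
           * s ^ (n - j) * (1 - s) ^ (j - k)"
        by (cases "j < n") (simp_all del: Stirling.simps)
    qed
    finally show ?thesis ..
  qed
  also have "(\<Sum>j\<le>n. ?h j) = gen_stirling s n k + (1 - s) * of_nat (Suc k) * gen_stirling s n (Suc k)"
    unfolding shift sum.distrib gen_stirling_eq_sum_atMost sum_distrib_left ..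
  finally show ?thesis by (simp add: algebra_simps)
qed

lemma gen_stirling_eq_0: "n < k \<Longrightarrow> gen_stirling s n k = 0"
  by (simp add: gen_stirling_def)

lemma gen_stirling_self: "gen_stirling s n n = 1"
  by (induction n) (simp_all add: gen_stirling_0_left gen_stirling_Suc_Suc gen_stirling_eq_0)

section \<open>The generating function and its powers\<close>

lemma fps_one_minus_cX_mult_deriv_nth:
  fixes f :: "'a::comm_ring_1 fps"
  shows "fps_nth ((1 - fps_const c * fps_X) * fps_deriv f) n =
    of_nat (Suc n) * fps_nth f (Suc n) - c * of_nat n * fps_nth f n"
  by (cases n) (simp_all add: left_diff_distrib mult.assoc del: of_nat_Suc)

text \<open>This is the series written F with index \<open>s\<close> in the exponent. Giving it by
  coefficients treats \<open>s = 0\<close>, \<open>s = 1\<close> and the remaining \<open>s\<close>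
  uniformly.\<close>

definition gen_stirling_egf :: "complex \<Rightarrow> complex fps" where
  "gen_stirling_egf s = Abs_fps (\<lambda>n. gen_stirling s n 1 / fact n)"

text \<open>This is the recurrence in column 1; column 0, which is 1 in row 0 and 0 below, supplies
  the constant 1.\<close>

lemma gen_stirling_egf_ode:
  "(1 - fps_const s * fps_X) * fps_deriv (gen_stirling_egf s) =
     1 + fps_const (1 - s) * gen_stirling_egf s"
proof (rule fps_ext)
  fix n
  let ?f = "gen_stirling_egf s"
  have d: "of_nat (Suc n) * fps_nth ?f (Suc n) = gen_stirling s (Suc n) 1 / fact n"
    by (simp add: gen_stirling_egf_def del: of_nat_Suc)
  have z: "gen_stirling s n 0 = (if n = 0 then 1 else 0)"
    by (cases n) (simp_all add: gen_stirling_0_left gen_stirling_Suc_0)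
  show "fps_nth ((1 - fps_const s * fps_X) * fps_deriv ?f) n =
      fps_nth (1 + fps_const (1 - s) * ?f) n"
    unfolding fps_one_minus_cX_mult_deriv_nth d
    using gen_stirling_Suc_Suc[of s n 0] z
    by (simp add: gen_stirling_egf_def field_simps)
qed

text \<open>The differential equation for \<open>f\<close>, multiplied by
  \<open>Suc m * f ^ m\<close>, becomes one for \<open>f ^ Suc m\<close>. Its coefficients satisfy
  the recurrence of \<open>gen_stirling\<close> up to the factorials, so induction on
  \<open>n\<close> works for all \<open>k\<close> at once.\<close>

lemma gen_stirling_egf_power_nth:
  "fps_nth (gen_stirling_egf s ^ k) n = fact k / fact n * gen_stirling s n k"
proof (induction n arbitrary: k)
  case 0
  then show ?case
    by (simp add: gen_stirling_0_left fps_power_zeroth gen_stirling_egf_def)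
next
  case (Suc n)
  let ?f = "gen_stirling_egf s"
  show ?case
  proof (cases k)
    case 0
    then show ?thesis by (simp add: gen_stirling_Suc_0)
  next
    case (Suc m)
    have "(1 - fps_const s * fps_X) * fps_deriv (?f ^ Suc m) =
        fps_const (of_nat (Suc m)) * ?f ^ m * ((1 - fps_const s * fps_X) * fps_deriv ?f)"
      unfolding fps_deriv_power diff_Suc_1 by (simp only: mult_ac)
    also have "\<dots> = fps_const (of_nat (Suc m)) * ?f ^ m
        + fps_const (of_nat (Suc m) * (1 - s)) * ?f ^ Suc m"
      unfolding gen_stirling_egf_ode distrib_left mult_1_right power_Suc fps_const_mult[symmetric]
      by (simp only: mult_ac)
    finally have eq: "(1 - fps_const s * fps_X) * fps_deriv (?f ^ Suc m) =
        fps_const (of_nat (Suc m)) * ?f ^ m + fps_const (of_nat (Suc m) * (1 - s)) * ?f ^ Suc m" .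
    from eq have "fps_nth ((1 - fps_const s * fps_X) * fps_deriv (?f ^ Suc m)) n =
       fps_nth (fps_const (of_nat (Suc m)) * ?f ^ m
          + fps_const (of_nat (Suc m) * (1 - s)) * ?f ^ Suc m) n"
      by simp
    then have "of_nat (Suc n) * fps_nth (?f ^ Suc m) (Suc n) =
      of_nat (Suc m) * fps_nth (?f ^ m) n
        + (s * of_nat n + (1 - s) * of_nat (Suc m)) * fps_nth (?f ^ Suc m) n"
      unfolding fps_one_minus_cX_mult_deriv_nth fps_add_nth fps_mult_left_const_nth by (simp only: algebra_simps)
    also have "\<dots> = fact (Suc m) / fact n * gen_stirling s (Suc n) (Suc m)"
      unfolding Suc.IH gen_stirling_Suc_Suc by (simp add: field_simps)
    finally have "fps_nth (?f ^ Suc m) (Suc n) =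
        fact (Suc m) / fact n * gen_stirling s (Suc n) (Suc m) / of_nat (Suc n)"
      by (metis nonzero_mult_div_cancel_left of_nat_eq_0_iff nat.distinct(2))
    then show ?thesis
      unfolding \<open>k = Suc m\<close> by (simp add: field_simps)
  qed
qed

section \<open>The elements \<open>R\<^sub>k\<close> and the coefficients of the
  exponentials\<close>

definition stirling_coeff ::
  "(complex \<Rightarrow> 'a \<Rightarrow> 'a) \<Rightarrow> (complex \<Rightarrow> 'a::{ring, monoid_mult}) \<Rightarrow> complex \<Rightarrow> complex \<Rightarrow> nat \<Rightarrow> 'a"
  where "stirling_coeff scale P h s k =
     (\<Sum>j=0..k. scale (gen_stirling s k j * h ^ (k - j)) (P (s * of_nat (k - j) + of_nat j)))"

lemma complex_powers_mult: "complex_powers P A \<Longrightarrow> P x * P y = P (x + y)"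
  by (simp add: complex_powers_def)

context complex_algebra
begin

lemmas scale_mult_simps = scale_mult_left scale_mult_right

text \<open>A product of \<open>k\<close> terms whose degrees add up to \<open>n\<close> carries
  \<open>h\<close> to the power \<open>n - k\<close> and the same power of \<open>A\<close>, however
  \<open>n\<close> is split. So only the scalar coefficients are convolved.\<close>

lemma exponent_series_power_nth:
  assumes "complex_powers P A"
  shows "fps_nth (exponent_series scale P h s ^ k) n =
    scale (fps_nth (gen_stirling_egf s ^ k) n * h ^ (n - k)) (P (s * of_nat (n - k) + of_nat k))"
proof (induction k arbitrary: n)
  case 0
  then show ?case using assms by (simp add: complex_powers_def)
next
  case (Suc k)
  let ?E = "exponent_series scale P h s" and ?f = "gen_stirling_egf s"
  have f0: "fps_nth ?f 0 = 0"
    by (simp add: gen_stirling_egf_def gen_stirling_0_left)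
  have "fps_nth ?E i * fps_nth (?E ^ k) (n - i) =
      scale (fps_nth ?f i * fps_nth (?f ^ k) (n - i) * h ^ (n - Suc k))
        (P (s * of_nat (n - Suc k) + of_nat (Suc k)))" if "i \<le> n" for i
  \<comment> \<open>Under this condition no subtraction is truncated; otherwise one of the two
    factors vanishes on each side.\<close>
  proof (cases "0 < i \<and> k \<le> n - i")
    case True
    then have n: "n - Suc k = (i - 1) + (n - i - k)" using True that by linarith
    have "P (s * of_nat (i - 1) + 1) * P (s * of_nat (n - i - k) + of_nat k) =
        P (s * of_nat (n - Suc k) + of_nat (Suc k))"
      unfolding n complex_powers_mult[OF assms] of_nat_add of_nat_Suc by (simp only: algebra_simps)
    moreover have "fps_nth ?E i = scale (fps_nth ?f i * h ^ (i - 1)) (P (s * of_nat (i - 1) + 1))"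
      using True by (simp add: exponent_series_def gen_stirling_egf_def)
    ultimately show ?thesis
      unfolding Suc.IH n power_add by (simp add: scale_mult_simps mult_ac)
  next
    case False
    then consider "i = 0" | "n - i < k" by linarith
    then show ?thesis
    proof cases
      case 1
      then show ?thesis by (simp add: f0 exponent_series_def)
    next
      case 2
      then show ?thesis by (simp add: Suc.IH fps_power_nth_eq_0[OF f0])
    qed
  qed
  then show ?case
    by (simp add: fps_mult_nth scale_sum_left sum_distrib_right)
qed

text \<open>The \<open>1 / fact k\<close> of the exponential cancels the \<open>fact k\<close> in
  the coefficients of \<open>gen_stirling_egf s ^ k\<close>.\<close>

lemma formal_exp_exponent_series_nth:
  assumes "complex_powers P A"
  shows "fps_nth (formal_exp scale (exponent_series scale P h s)) n =
    scale (1 / fact n) (stirling_coeff scale P h s n)"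
proof -
  have "fps_nth (exponent_series scale P h s) 0 = 0"
    by (simp add: exponent_series_def)
  then show ?thesis
    by (simp add: formal_exp_nth exponent_series_power_nth[OF assms] gen_stirling_egf_power_nth
        stirling_coeff_def scale_sum_right atLeast0AtMost)
qed

lemma formal_exp_const_X_nth:
  "fps_nth (formal_exp scale (fps_const C * fps_X)) n = scale (1 / fact n) (C ^ n)"
proof -
  have cX: "fps_nth (fps_const C * fps_X) i = (if i = 1 then C else 0)" for i
    by (simp add: fps_mult_left_const_nth fps_X_nth)
  have cX_power: "fps_nth ((fps_const C * fps_X) ^ k) m = (if m = k then C ^ k else 0)" for k m
  proof (induction k arbitrary: m)
    case (Suc k)
    have "fps_nth ((fps_const C * fps_X) ^ Suc k) m =
        (\<Sum>i=0..m. if i = 1 then (if m = Suc k then C ^ Suc k else 0) else 0)"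
      unfolding power_Suc fps_mult_nth[of "fps_const C * fps_X"] cX Suc.IH
      by (intro sum.cong) auto
    then show ?case by auto
  qed simp
  then show ?thesis
    using cX[of 0] by (simp add: formal_exp_nth cX_power if_distrib cong: if_cong)
qed

lemma formal_exp_product_nth:
  assumes "complex_powers P A"
  shows "fps_nth (formal_exp scale (exponent_series scale P h s) * formal_exp scale (fps_const B * fps_X)) n
    = scale (1 / fact n)
       (\<Sum>k=0..n. scale (of_nat (n choose k)) (stirling_coeff scale P h s k * B ^ (n - k)))"
  unfolding fps_mult_nth formal_exp_exponent_series_nth[OF assms] formal_exp_const_X_nth scale_sum_right
  by (intro sum.cong) (simp_all add: scale_mult_simps binomial_fact)

lemma formal_exp_eq_iff:
  assumes "complex_powers P A"
  shows "formal_exp scale (fps_const C * fps_X) =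
      formal_exp scale (exponent_series scale P h s) * formal_exp scale (fps_const B * fps_X) \<longleftrightarrow>
    (\<forall>n. C ^ n = (\<Sum>k=0..n. scale (of_nat (n choose k)) (stirling_coeff scale P h s k * B ^ (n - k))))"
  unfolding fps_eq_iff formal_exp_product_nth[OF assms] formal_exp_const_X_nth by simp

section \<open>Reindexing and Pascal's rule\<close>

lemma stirling_sum_reindex:
  "(\<Sum>k=0..n. scale (of_nat (n choose k)) (stirling_coeff scale P h s k * B ^ (n - k))) =
   (\<Sum>k=0..n. scale (h ^ (n - k))
      (\<Sum>j=0..k. scale (of_nat (n choose j) * gen_stirling s (n - j) (k - j))
         (P (s * of_nat (n - k) + of_nat (k - j)) * B ^ j)))" (is "?L = ?R")
proof -
  have "?L = (\<Sum>k=0..n. \<Sum>j=0..k. scale (of_nat (n choose k) * (gen_stirling s k j * h ^ (k - j)))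
      (P (s * of_nat (k - j) + of_nat j) * B ^ (n - k)))"
    by (simp add: stirling_coeff_def sum_distrib_right scale_sum_right scale_mult_simps)
  also have "\<dots> = (\<Sum>(k, j)\<in>Sigma {0..n} (\<lambda>k. {0..k}).
      scale (of_nat (n choose k) * (gen_stirling s k j * h ^ (k - j)))
        (P (s * of_nat (k - j) + of_nat j) * B ^ (n - k)))"
    by (rule sum.Sigma) simp_all
  also have "\<dots> = (\<Sum>(k, j)\<in>Sigma {0..n} (\<lambda>k. {0..k}).
      scale (h ^ (n - k) * (of_nat (n choose j) * gen_stirling s (n - j) (k - j)))
        (P (s * of_nat (n - k) + of_nat (k - j)) * B ^ j))"
    \<comment> \<open>The new inner index is the exponent \<open>n - k\<close> of \<open>B\<close>.
      The new outer index \<open>n - k + j\<close> is chosen so that its difference from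
      \<open>n\<close> is the exponent \<open>k - j\<close> of \<open>h\<close>.\<close>
    by (rule sum.reindex_bij_witness[where i = "\<lambda>(k, j). (n - j, k - j)"
          and j = "\<lambda>(k, j). (n - k + j, n - k)"])
      (auto simp: mult_ac binomial_symmetric[symmetric])
  also have "\<dots> = ?R"
    by (subst sum.Sigma[symmetric]) (simp_all add: scale_sum_right)
  finally show ?thesis .
qed

lemma sum_choose_Suc:
  "(\<Sum>k\<le>Suc n. scale (of_nat (Suc n choose k)) (g k)) =
   (\<Sum>k\<le>n. scale (of_nat (n choose k)) (g k + g (Suc k)))"
proof -
  have "(\<Sum>k\<le>n. scale (of_nat (n choose k)) (g k)) = (\<Sum>k\<le>Suc n. scale (of_nat (n choose k)) (g k))"
    by simp
  also have "\<dots> = g 0 + (\<Sum>k\<le>n. scale (of_nat (n choose Suc k)) (g (Suc k)))"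
    by (subst sum.atMost_Suc_shift) simp
  finally have "(\<Sum>k\<le>n. scale (of_nat (n choose k)) (g k)) =
    g 0 + (\<Sum>k\<le>n. scale (of_nat (n choose Suc k)) (g (Suc k)))" .
  then show ?thesis
    by (subst sum.atMost_Suc_shift)
      (simp add: sum.distrib scale_left_distrib scale_right_distrib add_ac)
qed

section \<open>Commutation of \<open>B\<close> with powers of \<open>A\<close>\<close>

text \<open>A predicate of \<open>x\<close>, since the rule may hold on a proper subgroup of
  exponents only. At \<open>x = 1\<close> it is (i).\<close>

definition power_rule :: "(complex \<Rightarrow> 'a) \<Rightarrow> 'a \<Rightarrow> complex \<Rightarrow> complex \<Rightarrow> complex \<Rightarrow> bool" where
  "power_rule P B h s x \<longleftrightarrow> B * P x = P x * B + scale (h * x) (P (x + s))"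

lemma power_rule_0: "complex_powers P A \<Longrightarrow> power_rule P B h s 0"
  by (simp add: power_rule_def complex_powers_def)

text \<open>Leibniz rule for the commutator with \<open>B\<close>.\<close>

lemma power_rule_add:
  assumes P: "complex_powers P A" and x: "power_rule P B h s x" and y: "power_rule P B h s y"
  shows "power_rule P B h s (x + y)"
proof -
  have "B * P (x + y) = (B * P x) * P y"
    by (simp add: complex_powers_mult[OF P] mult.assoc)
  also have "\<dots> = P x * (B * P y) + scale (h * x) (P (x + s) * P y)"
    using x by (simp add: power_rule_def algebra_simps scale_mult_simps)
  also have "\<dots> = P x * P y * B + scale (h * y) (P x * P (y + s)) + scale (h * x) (P (x + s) * P y)"
    using y by (simp add: power_rule_def algebra_simps scale_mult_simps)
  also have "\<dots> = P (x + y) * B + scale (h * (x + y)) (P (x + y + s))"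
    unfolding complex_powers_mult[OF P] by (simp add: algebra_simps scale_left_distrib)
  finally show ?thesis by (simp add: power_rule_def)
qed

text \<open>\<open>P (- x)\<close> is inverse to \<open>P x\<close>; multiplying the rule for
  \<open>x\<close> by it on both sides gives the rule for \<open>- x\<close>.\<close>

lemma power_rule_minus:
  assumes P: "complex_powers P A" and x: "power_rule P B h s x"
  shows "power_rule P B h s (- x)"
proof -
  have P0: "P 0 = 1" and inv: "P (- x) * P x = 1" "P x * P (- x) = 1"
    using P by (simp_all add: complex_powers_def)
  have "P (- x) * B = P (- x) * (B * P x) * P (- x)"
    by (simp add: mult.assoc inv)
  also have "\<dots> = (P (- x) * P x) * B * P (- x) + scale (h * x) (P (- x) * P (x + s) * P (- x))"
    using x by (simp add: power_rule_def algebra_simps scale_mult_simps)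
  also have "\<dots> = B * P (- x) + scale (h * x) (P (- x + s))"
    unfolding inv complex_powers_mult[OF P] by (simp add: P0 algebra_simps)
  finally show ?thesis by (simp add: power_rule_def algebra_simps)
qed

lemma power_rule_of_nat_mult:
  assumes "complex_powers P A" "power_rule P B h s x"
  shows "power_rule P B h s (x * of_nat n)"
  using assms by (induction n) (auto simp: algebra_simps intro: power_rule_0 power_rule_add)

lemma power_rule_Ints:
  assumes P: "complex_powers P A" and "power_rule P B h s 1" "x \<in> \<int>"
  shows "power_rule P B h s x"
proof -
  obtain m where m: "x = of_int m" using \<open>x \<in> \<int>\<close> by (elim Ints_cases)
  have nat: "power_rule P B h s (of_nat n)" for n
    using power_rule_of_nat_mult[OF P assms(2), of n] by simp
  show ?thesis unfolding m by (cases m rule: int_cases2) (auto intro: nat power_rule_minus[OF P])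
qed

section \<open>Expansion of the powers of \<open>A + B\<close>\<close>

text \<open>All exponents in \<open>R\<^sub>k\<close> lie in the group generated by 1 and
  \<open>s\<close>. Multiplication by \<open>A\<close> moves the term \<open>j\<close> to
  \<open>Suc j\<close>; the commutator with \<open>B\<close> keeps \<open>j\<close> and contributes
  \<open>h\<close> times the exponent \<open>s * (k - j) + j\<close>, which is the factor in the
  recurrence.\<close>

lemma stirling_coeff_Suc:
  assumes P: "complex_powers P A" and 1: "power_rule P B h s 1" and s: "power_rule P B h s s"
  shows "(A + B) * stirling_coeff scale P h s k =
    stirling_coeff scale P h s k * B + stirling_coeff scale P h s (Suc k)"
proof -
  let ?e = "\<lambda>j. s * of_nat (k - j) + of_nat j"
  let ?g = "\<lambda>j. gen_stirling s k j * h ^ (k - j)"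
  let ?Q = "\<lambda>j. P (s * of_nat (Suc k - j) + of_nat j)"
  have "power_rule P B h s (?e j)" for j
    using power_rule_add[OF P power_rule_of_nat_mult[OF P s] power_rule_of_nat_mult[OF P 1]]
    by simp
  then have "B * P (?e j) = P (?e j) * B + scale (h * ?e j) (P (?e j + s))" for j
    by (simp add: power_rule_def)
  moreover have "A * P (?e j) = P (?e j + 1)" for j
    using P complex_powers_mult[OF P, of 1] by (simp add: complex_powers_def add.commute)
  ultimately have step: "(A + B) * scale (?g j) (P (?e j)) = scale (?g j) (P (?e j)) * B
      + (scale (?g j * h * ?e j) (P (?e j + s)) + scale (?g j) (P (?e j + 1)))" for j
    by (simp add: distrib_right scale_mult_simps scale_right_distrib mult_ac add_ac)
  have ft: "scale (?g j) (P (?e j + 1)) = scale (gen_stirling s k j * h ^ (Suc k - Suc j)) (?Q (Suc j))" for j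
    by (simp add: add_ac)
  have st: "scale (?g j * h * ?e j) (P (?e j + s)) =
     scale ((s * of_nat k + (1 - s) * of_nat j) * gen_stirling s k j * h ^ (Suc k - j)) (?Q j)"
    if "j \<le> k" for j
    using that by (simp add: Suc_diff_le of_nat_diff algebra_simps)
  have "(\<Sum>j\<le>k. scale (?g j * h * ?e j) (P (?e j + s))) =
     (\<Sum>j\<le>k. scale ((s * of_nat k + (1 - s) * of_nat j) * gen_stirling s k j * h ^ (Suc k - j)) (?Q j))"
    by (intro sum.cong) (simp_all only: st atMost_iff)
  also have "\<dots> = (\<Sum>j\<le>Suc k. scale ((s * of_nat k + (1 - s) * of_nat j) * gen_stirling s k j * h ^ (Suc k - j)) (?Q j))"
    by (simp add: gen_stirling_eq_0)
  \<comment> \<open>The dropped term \<open>j = 0\<close> vanishes: for \<open>k = 0\<close> its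
    factor \<open>s * k\<close> is 0, for \<open>k > 0\<close> the number
    \<open>gen_stirling s k 0\<close> is 0.\<close>
  also have "\<dots> = (\<Sum>j\<le>k. scale ((s * of_nat k + (1 - s) * of_nat (Suc j)) * gen_stirling s k (Suc j)
        * h ^ (Suc k - Suc j)) (?Q (Suc j)))"
    by (subst sum.atMost_Suc_shift) (cases k; simp add: gen_stirling_Suc_0)
  finally have commutator_part: "(\<Sum>j\<le>k. scale (?g j * h * ?e j) (P (?e j + s))) =
     (\<Sum>j\<le>k. scale ((s * of_nat k + (1 - s) * of_nat (Suc j)) * gen_stirling s k (Suc j)
        * h ^ (Suc k - Suc j)) (?Q (Suc j)))" .
  have rec: "scale (gen_stirling s (Suc k) (Suc j) * c) v =
      scale ((s * of_nat k + (1 - s) * of_nat (Suc j)) * gen_stirling s k (Suc j) * c) v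
      + scale (gen_stirling s k j * c) v" for j c v
    unfolding gen_stirling_Suc_Suc distrib_right[of "gen_stirling s k j"] scale_left_distrib
    by (rule add.commute)
  have "(\<Sum>j\<le>k. scale (?g j * h * ?e j) (P (?e j + s)) + scale (?g j) (P (?e j + 1))) =
     (\<Sum>j\<le>k. scale (gen_stirling s (Suc k) (Suc j) * h ^ (Suc k - Suc j)) (?Q (Suc j)))"
    unfolding sum.distrib commutator_part ft rec ..
  also have "\<dots> = stirling_coeff scale P h s (Suc k)"
    unfolding stirling_coeff_def atLeast0AtMost
    by (subst sum.atMost_Suc_shift) (simp add: gen_stirling_Suc_0)
  finally show ?thesis
    unfolding stirling_coeff_def[of scale P h s k] atLeast0AtMost sum_distrib_left sum_distrib_right step sum.distrib
    by simp
qed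

text \<open>A left factor \<open>A + B\<close> turns \<open>R\<^sub>k\<close> into
  \<open>R\<^sub>k * B\<close> plus the next coefficient: either the exponent of \<open>B\<close> or
  the index \<open>k\<close> grows by one, and Pascal's rule collects the terms.\<close>

lemma power_add_eq_stirling_sum:
  assumes "complex_powers P A" "power_rule P B h s 1" "power_rule P B h s s"
  shows "(A + B) ^ n =
    (\<Sum>k=0..n. scale (of_nat (n choose k)) (stirling_coeff scale P h s k * B ^ (n - k)))"
proof (induction n)
  case 0
  show ?case using assms(1) by (simp add: stirling_coeff_def gen_stirling_0_left complex_powers_def)
next
  case (Suc n)
  let ?R = "stirling_coeff scale P h s"
  have "(A + B) ^ Suc n = (\<Sum>k\<le>n. scale (of_nat (n choose k)) ((A + B) * ?R k * B ^ (n - k)))"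
    by (simp add: Suc.IH atLeast0AtMost sum_distrib_left scale_mult_simps mult.assoc)
  also have "\<dots> = (\<Sum>k\<le>n. scale (of_nat (n choose k))
      (?R k * B ^ (Suc n - k) + ?R (Suc k) * B ^ (Suc n - Suc k)))"
    by (intro sum.cong)
      (simp_all only: stirling_coeff_Suc[OF assms], simp_all add: distrib_right mult.assoc Suc_diff_le)
  also have "\<dots> = (\<Sum>k\<le>Suc n. scale (of_nat (Suc n choose k)) (?R k * B ^ (Suc n - k)))"
    by (rule sum_choose_Suc[symmetric])
  finally show ?case by (simp only: atLeast0AtMost)
qed

section \<open>Recovering (i), and the rule at \<open>1\<close> and \<open>s\<close>\<close>

text \<open>The coefficient with index 2 is \<open>A * A + scale h (P (s + 1))\<close>. Comparing
  with the direct expansion of the square leaves \<open>B * A - A * B\<close> on one side and the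
  \<open>h\<close> term on the other.\<close>

lemma power2_eq_stirling_sumD:
  assumes P: "complex_powers P A"
    and eq: "(A + B) ^ 2 =
      (\<Sum>k=0..2. scale (of_nat (2 choose k)) (stirling_coeff scale P h s k * B ^ (2 - k)))"
  shows "commutator B A = scale h (P (s + 1))"
proof -
  have P1: "P 0 = 1" "P 1 = A" "P 2 = A * A"
    using P complex_powers_mult[OF P, of 1 1] by (simp_all add: complex_powers_def)
  have "gen_stirling s 2 1 = 1"
    using gen_stirling_Suc_Suc[of s 1 0] gen_stirling_Suc_0[of s 0] gen_stirling_self[of s 1]
    by (simp add: numeral_2_eq_2)
  moreover have "gen_stirling s 2 0 = 0" "gen_stirling s 1 0 = 0"
    using gen_stirling_Suc_0[of s] by (simp_all add: numeral_2_eq_2)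
  ultimately have R: "stirling_coeff scale P h s 0 = 1" "stirling_coeff scale P h s 1 = A"
      "stirling_coeff scale P h s 2 = A * A + scale h (P (s + 1))"
    by (simp_all add: stirling_coeff_def gen_stirling_self P1 numeral_2_eq_2 add_ac)
  have "{0..2} = {0, 1, 2::nat}" by auto
  then have "(A + B) * (A + B) = B * B + scale 2 (A * B) + (A * A + scale h (P (s + 1)))"
    using eq by (simp add: R R(2)[unfolded One_nat_def] power2_eq_square add_ac)
  moreover have "scale 2 (A * B) = A * B + A * B"
    using scale_left_distrib[of 1 1 "A * B"] by simp
  ultimately show ?thesis by (simp add: commutator_def algebra_simps)
qed

lemma power_rule_of_commutator:
  assumes P: "complex_powers P A" and i: "commutator B A = scale h (P (s + 1))"
    and D: "s \<notin> \<int> \<Longrightarrow> commutator (commutator B A) A = 0 \<Longrightarrow>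
           commutator B (P s) = scale s (P (s - 1) * commutator B A)"
  shows "power_rule P B h s 1" "power_rule P B h s s"
proof -
  have P1: "P 1 = A" using P by (simp add: complex_powers_def)
  show 1: "power_rule P B h s 1"
    using i by (simp add: power_rule_def P1 commutator_def algebra_simps)
  show "power_rule P B h s s"
  proof (cases "s \<in> \<int>")
    case True
    then show ?thesis by (rule power_rule_Ints[OF P 1])
  next
    case False
    \<comment> \<open>By (i), \<open>commutator B A\<close> is a multiple of a power of
      \<open>A\<close>, so it commutes with \<open>A\<close>, as \<open>D\<close> requires.\<close>
    have "P (s + 1) * A = A * P (s + 1)"
      using P P1 by (metis complex_powers_def)
    then have "commutator (commutator B A) A = 0"
      unfolding i by (simp add: commutator_def scale_mult_simps)
    then have "commutator B (P s) = scale (h * s) (P (s - 1) * P (s + 1))"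
      using D[OF False] by (simp add: i scale_mult_simps mult.commute)
    also have "P (s - 1) * P (s + 1) = P (s + s)"
      by (simp add: complex_powers_mult[OF P])
    finally show ?thesis by (simp add: power_rule_def commutator_def algebra_simps)
  qed
qed

end

text \<open>The third hypothesis is the derivation rule for \<open>P s\<close> at non-integer
  \<open>s\<close>, which the power laws do not supply. It is asked for only if
  \<open>commutator B A\<close> commutes with \<open>A\<close>, as it does under (i).\<close>

theorem theorem6p2:
  fixes scale :: "complex \<Rightarrow> 'a \<Rightarrow> 'a::{ring, monoid_mult}"
    and A B :: 'a and P :: "complex \<Rightarrow> 'a" and h s :: complex
  assumes "complex_algebra scale"
    and "complex_powers P A"
    and "s \<notin> \<int> \<Longrightarrow> commutator (commutator B A) A = 0 \<Longrightarrow>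
           commutator B (P s) = scale s (P (s - 1) * commutator B A)"
  defines "i \<equiv> commutator B A = scale h (P (s + 1))"
    and "ii \<equiv> \<forall>n::nat.
           (A + B) ^ n =
             (\<Sum>k=0..n. scale (of_nat (n choose k))
                ((\<Sum>j=0..k. scale (gen_stirling s k j * h ^ (k - j))
                     (P (s * of_nat (k - j) + of_nat j))) * B ^ (n - k)))
         \<and> (A + B) ^ n =
             (\<Sum>k=0..n. scale (h ^ (n - k))
                (\<Sum>j=0..k. scale (of_nat (n choose j) * gen_stirling s (n - j) (k - j))
                     (P (s * of_nat (n - k) + of_nat (k - j)) * B ^ j)))"
    and "iii \<equiv> formal_exp scale (fps_const (A + B) * fps_X) =
           formal_exp scale (exponent_series scale P h s) * formal_exp scale (fps_const B * fps_X)"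
  shows "(i \<longleftrightarrow> ii) \<and> (ii \<longleftrightarrow> iii)"
proof -
  interpret complex_algebra scale by (fact assms(1))
  note P = \<open>complex_powers P A\<close>
  let ?sum = "\<lambda>n. \<Sum>k=0..n. scale (of_nat (n choose k)) (stirling_coeff scale P h s k * B ^ (n - k))"
  \<comment> \<open>Both (ii) and (iii) reduce to this one family of identities, which is then
    compared with (i).\<close>
  have ii: "ii \<longleftrightarrow> (\<forall>n. (A + B) ^ n = ?sum n)"
    unfolding ii_def stirling_sum_reindex[symmetric] stirling_coeff_def[symmetric] by simp
  moreover have "iii \<longleftrightarrow> (\<forall>n. (A + B) ^ n = ?sum n)"
    unfolding iii_def by (rule formal_exp_eq_iff[OF P])
  moreover have "(A + B) ^ n = ?sum n" if i for n
    using that power_rule_of_commutator[OF P _ assms(3)] power_add_eq_stirling_sum[OF P]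
    unfolding i_def by blast
  moreover have i if "\<forall>n. (A + B) ^ n = ?sum n"
    unfolding i_def using power2_eq_stirling_sumD[OF P] that by blast
  ultimately show ?thesis by blast
qed

end
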